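(* Let $\mathbb{V}_1$ and $\mathbb{V}_2$ be two finite dimensional vector spaces over the same field $\mathbb{F}$, each of dimension greater than $1$. Then $\mathbb{V}_1$ and $\mathbb{V}_2$ are isomorphic as vector spaces if and only if the subspace sum graphs $\mathcal{G}(\mathbb{V}_1)$ and $\mathcal{G}(\mathbb{V}_2)$ are isomorphic as graphs.
   Context: For a finite dimensional vector space $\mathbb{V}$ over a field $\mathbb{F}$ with $\dim(\mathbb{V})>1$, the subspace sum graph $\mathcal{G}(\mathbb{V})$ is the graph whose vertices are the non-trivial proper subspaces of $\mathbb{V}$ (subspaces $W$ with $W\neq\{0\}$ and $W\neq\mathbb{V}$), two vertices $W_1,W_2$ being adjacent if and only if $W_1+W_2=\mathbb{V}$. Two graphs are isomorphic if there is a bijection between their vertex sets preserving adjacency in both directions. *)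

theory Defs
  imports Complex_Main "HOL-Library.Set_Algebras"
begin

(* A vector space is given, as in Vector_Spaces, by its scalar multiplication
   scale :: 'a::field => 'v::ab_group_add => 'v; its vectors are all elements of 'v. *)

definition vector_space_iso ::
    "('a::field \<Rightarrow> 'v::ab_group_add \<Rightarrow> 'v) \<Rightarrow> ('a \<Rightarrow> 'w::ab_group_add \<Rightarrow> 'w) \<Rightarrow> bool"
  where "vector_space_iso s1 s2 \<longleftrightarrow> (\<exists>f. Vector_Spaces.linear s1 s2 f \<and> bij f)"

record 'v graph =
  verts :: "'v set"
  adj :: "'v \<Rightarrow> 'v \<Rightarrow> bool"

definition graph_iso :: "'v graph \<Rightarrow> 'w graph \<Rightarrow> bool"
  where "graph_iso G H \<longleftrightarrow>
    (\<exists>\<phi>. bij_betw \<phi> (verts G) (verts H) \<and>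
         (\<forall>x\<in>verts G. \<forall>y\<in>verts G. adj G x y \<longleftrightarrow> adj H (\<phi> x) (\<phi> y)))"

definition proper_subspaces :: "('a::field \<Rightarrow> 'v::ab_group_add \<Rightarrow> 'v) \<Rightarrow> 'v set set"
  where "proper_subspaces scale = {W. module.subspace scale W \<and> W \<noteq> {0} \<and> W \<noteq> UNIV}"

(* The + between W1 and W2 is the elementwise sum of sets from Set_Algebras. *)
definition subspace_sum_graph :: "('a::field \<Rightarrow> 'v::ab_group_add \<Rightarrow> 'v) \<Rightarrow> 'v set graph"
  where "subspace_sum_graph scale =
    \<lparr> verts = proper_subspaces scale,
      adj = (\<lambda>W1 W2. W1 \<in> proper_subspaces scale \<and> W2 \<in> proper_subspaces scale \<and>
                     W1 + W2 = UNIV) \<rparr>"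

lemma subspace_sum_graph_sym:
  "adj (subspace_sum_graph scale) W1 W2 \<Longrightarrow> adj (subspace_sum_graph scale) W2 W1"
  by (simp add: subspace_sum_graph_def add.commute)

(* Distinctness of adjacent vertices need not be required: W + W = W for a subspace W. *)
lemma subspace_sum_graph_irrefl:
  assumes "vector_space scale"
  shows "\<not> adj (subspace_sum_graph scale) W W"
proof
  interpret vector_space scale by fact
  assume "adj (subspace_sum_graph scale) W W"
  then have W: "subspace W" "W \<noteq> UNIV" "W + W = UNIV"
    by (simp_all add: subspace_sum_graph_def proper_subspaces_def)
  have "W + W \<subseteq> W"
    using W(1) by (auto simp: set_plus_def subspace_add)
  with W(2,3) show False by auto
qed

end

theory Submission
  imports Defs
begin

text \<open>
  A linear bijection carries subspaces to subspaces and sums to sums, so it induces an isomorphism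
  of the subspace sum graphs.

  Conversely, the graph determines the inclusion order on its vertices:
  \<open>W\<^sub>1 \<subseteq> W\<^sub>2\<close> holds exactly when every neighbour of \<open>W\<^sub>1\<close> is a neighbour
  of \<open>W\<^sub>2\<close>. Indeed, a vector of \<open>W\<^sub>1\<close> outside \<open>W\<^sub>2\<close> is missed by some hyperplane
  containing \<open>W\<^sub>2\<close>, and this hyperplane is a neighbour of \<open>W\<^sub>1\<close> but not of \<open>W\<^sub>2\<close>. A graph
  isomorphism is therefore an order isomorphism of the proper subspaces. The longest chains of
  proper subspaces in a space of dimension \<open>n > 0\<close> have \<open>n - 1\<close> members, so isomorphic graphs come
  from spaces of the same dimension, and over a common field such spaces are isomorphic. Comparing
  lengths of chains, rather than counting subspaces, works over infinite fields as well.
\<close>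

lemma graph_iso_sym:
  assumes "graph_iso G H"
  shows "graph_iso H G"
proof -
  obtain \<phi> where bij: "bij_betw \<phi> (verts G) (verts H)"
    and adj: "\<forall>x\<in>verts G. \<forall>y\<in>verts G. adj G x y \<longleftrightarrow> adj H (\<phi> x) (\<phi> y)"
    using assms by (auto simp: graph_iso_def)
  let ?\<psi> = "inv_into (verts G) \<phi>"
  have "bij_betw ?\<psi> (verts H) (verts G)"
    by (rule bij_betw_inv_into[OF bij])
  moreover have "adj H x y \<longleftrightarrow> adj G (?\<psi> x) (?\<psi> y)" if "x \<in> verts H" "y \<in> verts H" for x y
    using that adj bij calculation by (simp add: bij_betw_apply bij_betw_inv_into_right)
  ultimately show ?thesis
    unfolding graph_iso_def by blast
qed

section \<open>From linear isomorphisms to graph isomorphisms\<close>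

lemma image_set_plus_additive:
  assumes "\<And>x y. f (x + y) = f x + f y"
  shows "f ` (A + B) = f ` A + f ` B"
proof
  show "f ` (A + B) \<subseteq> f ` A + f ` B"
    by (auto elim!: set_plus_elim intro!: set_plus_intro simp: assms)
  show "f ` A + f ` B \<subseteq> f ` (A + B)"
    by (auto elim!: set_plus_elim simp: assms[symmetric])
qed

lemma graph_iso_if_vector_space_iso:
  assumes "vector_space_iso s1 s2"
  shows "graph_iso (subspace_sum_graph s1) (subspace_sum_graph s2)"
proof -
  obtain f where lin: "Vector_Spaces.linear s1 s2 f" and bij: "bij f"
    using assms by (auto simp: vector_space_iso_def)
  interpret f: Vector_Spaces.linear s1 s2 f by (rule lin)
  have inj: "inj f" and surj: "surj f"
    using bij by (auto simp: bij_def)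
  have proper: "f ` W \<in> proper_subspaces s2 \<longleftrightarrow> W \<in> proper_subspaces s1" for W
  proof -
    have "f.vs2.subspace (f ` W) \<longleftrightarrow> f.vs1.subspace W"
      using f.subspace_image[of W] f.subspace_vimage[of "f ` W"] inj
      by (auto simp: inj_vimage_image_eq)
    moreover have "f ` W = {0} \<longleftrightarrow> W = {0}"
      using inj_image_eq_iff[OF inj, of W "{0}"] by (simp add: f.zero)
    moreover have "f ` W = UNIV \<longleftrightarrow> W = UNIV"
      using inj_image_eq_iff[OF inj, of W UNIV] surj by simp
    ultimately show ?thesis
      by (simp add: proper_subspaces_def)
  qed
  have sum: "f ` A + f ` B = UNIV \<longleftrightarrow> A + B = UNIV" for A B
    using inj_image_eq_iff[OF inj, of "A + B" UNIV] surj
      image_set_plus_additive[of f A B, OF f.add] by simp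
  have "bij_betw (image f) (proper_subspaces s1) (proper_subspaces s2)"
  proof (rule bij_betw_imageI)
    show "inj_on (image f) (proper_subspaces s1)"
      using inj by (simp add: inj_on_def inj_image_eq_iff)
    have "U \<in> image f ` proper_subspaces s1" if "U \<in> proper_subspaces s2" for U
      using that proper[of "f -` U"] surj by (auto simp: surj_image_vimage_eq intro!: image_eqI[of _ _ "f -` U"])
    then show "image f ` proper_subspaces s1 = proper_subspaces s2"
      using proper by blast
  qed
  then show ?thesis
    unfolding graph_iso_def
    by (intro exI[of _ "image f"]) (simp add: subspace_sum_graph_def proper sum)
qed

section \<open>Inclusion of subspaces in terms of adjacency\<close>

text \<open>The hyperplane is spanned by a basis of the space with \<open>w\<close> removed, where the basis extends
  \<open>w\<close> together with a basis of \<open>W\<close>.\<close>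

lemma (in vector_space) complementary_hyperplane:
  assumes W: "subspace W" and w: "w \<notin> W"
  obtains H where "subspace H" "W \<subseteq> H" "w \<notin> H" "span {w} + H = UNIV"
proof -
  obtain B where B: "B \<subseteq> W" "independent B" "W \<subseteq> span B"
    using maximal_independent_subset[of W] by blast
  have spanB: "span B = W"
    using B W by (simp add: span_subspace)
  have ind: "independent (insert w B)"
    using B(2) w spanB by (simp add: independent_insertI)
  define C where "C = extend_basis (insert w B)"
  have C: "insert w B \<subseteq> C" "independent C" "span C = UNIV"
    unfolding C_def
    by (rule extend_basis_superset[OF ind] independent_extend_basis[OF ind] span_extend_basis[OF ind])+
  define H where "H = span (C - {w})"
  show ?thesis
  proof
    show "subspace H" by (simp add: H_def)
    have "B \<subseteq> C - {w}"
      using B(1) w C(1) by auto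
    then show "W \<subseteq> H"
      unfolding H_def spanB[symmetric] by (rule span_mono)
    show "w \<notin> H"
      using C(1,2) by (auto simp: H_def dependent_def)
    have "{w} \<union> (C - {w}) = C"
      using C(1) by auto
    then show "span {w} + H = UNIV"
      using span_Un[of "{w}" "C - {w}"] C(3) by (simp add: H_def set_plus_def) blast
  qed
qed

text \<open>If \<open>w \<in> W1\<close> lies outside \<open>W2\<close>, take \<open>U\<close> to be a hyperplane that contains \<open>W2\<close>
  and misses \<open>w\<close>: it absorbs \<open>W2\<close>, while \<open>w\<close> alone completes it to the whole space. The other
  direction is monotonicity of the sum.\<close>

lemma (in vector_space) neighbours_subset_iff:
  assumes W1: "W1 \<in> proper_subspaces scale" and W2: "W2 \<in> proper_subspaces scale"
  shows "(\<forall>U\<in>proper_subspaces scale.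
      adj (subspace_sum_graph scale) W1 U \<longrightarrow> adj (subspace_sum_graph scale) W2 U) \<longleftrightarrow> W1 \<subseteq> W2"
    (is "?L \<longleftrightarrow> _")
proof
  assume "W1 \<subseteq> W2"
  then have "W1 + U \<subseteq> W2 + U" for U
    by (simp add: set_plus_mono2)
  then show ?L
    using W2 by (auto simp: subspace_sum_graph_def)
next
  assume L: ?L
  show "W1 \<subseteq> W2"
  proof (rule ccontr)
    assume "\<not> W1 \<subseteq> W2"
    then obtain w where w: "w \<in> W1" "w \<notin> W2" by blast
    have sub: "subspace W1" "subspace W2" "W2 \<noteq> {0}"
      using W1 W2 by (auto simp: proper_subspaces_def)
    obtain H where H: "subspace H" "W2 \<subseteq> H" "w \<notin> H" "span {w} + H = UNIV"
      using complementary_hyperplane[OF sub(2) w(2)] by blast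
    have "H \<noteq> {0}"
      using sub(2,3) H(2) subspace_0 by blast
    then have HV: "H \<in> proper_subspaces scale"
      using H(1,3) by (auto simp: proper_subspaces_def)
    have "span {w} \<subseteq> W1"
      using w(1) sub(1) by (simp add: span_minimal)
    then have "W1 + H = UNIV"
      using H(4) set_plus_mono2[of "span {w}" W1 H H] by auto
    then have "W2 + H = UNIV"
      using L W1 HV by (auto simp: subspace_sum_graph_def)
    moreover have "W2 + H \<subseteq> H"
      using H(1,2) by (auto simp: set_plus_def intro: subspace_add)
    ultimately show False
      using H(3) by auto
  qed
qed

text \<open>Since \<open>\<phi>\<close> is onto, the neighbours of \<open>\<phi> X\<close> are exactly the images of the neighbours of
  \<open>X\<close>, so containment of neighbourhoods is the same on both sides.\<close>

lemma graph_iso_imp_order_iso: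
  assumes "vector_space s1" and "vector_space s2"
    and "graph_iso (subspace_sum_graph s1) (subspace_sum_graph s2)"
  obtains \<phi> where "bij_betw \<phi> (proper_subspaces s1) (proper_subspaces s2)"
    and "\<And>X Y. \<lbrakk>X \<in> proper_subspaces s1; Y \<in> proper_subspaces s1\<rbrakk> \<Longrightarrow> \<phi> X \<subseteq> \<phi> Y \<longleftrightarrow> X \<subseteq> Y"
proof -
  let ?P1 = "proper_subspaces s1" and ?P2 = "proper_subspaces s2"
  let ?G1 = "subspace_sum_graph s1" and ?G2 = "subspace_sum_graph s2"
  have verts: "verts ?G1 = ?P1" "verts ?G2 = ?P2"
    by (simp_all add: subspace_sum_graph_def)
  obtain \<phi> where bij: "bij_betw \<phi> ?P1 ?P2"
    and adj: "\<forall>x\<in>?P1. \<forall>y\<in>?P1. adj ?G1 x y \<longleftrightarrow> adj ?G2 (\<phi> x) (\<phi> y)"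
    using assms(3) unfolding graph_iso_def verts by blast
  have img: "\<phi> ` ?P1 = ?P2"
    using bij by (simp add: bij_betw_def)
  have "\<phi> X \<subseteq> \<phi> Y \<longleftrightarrow> X \<subseteq> Y" if X: "X \<in> ?P1" and Y: "Y \<in> ?P1" for X Y
  proof -
    have "\<phi> X \<subseteq> \<phi> Y \<longleftrightarrow> (\<forall>U\<in>\<phi> ` ?P1. adj ?G2 (\<phi> X) U \<longrightarrow> adj ?G2 (\<phi> Y) U)"
      using vector_space.neighbours_subset_iff[OF assms(2), of "\<phi> X" "\<phi> Y"] X Y img by blast
    also have "\<dots> \<longleftrightarrow> (\<forall>U\<in>?P1. adj ?G1 X U \<longrightarrow> adj ?G1 Y U)"
      using adj X Y by auto
    also have "\<dots> \<longleftrightarrow> X \<subseteq> Y"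
      by (rule vector_space.neighbours_subset_iff[OF assms(1) X Y])
    finally show ?thesis .
  qed
  with bij show ?thesis
    by (rule that)
qed

section \<open>The dimension in terms of chains of subspaces\<close>

context finite_dimensional_vector_space
begin

lemma dim_proper_subspace:
  assumes "W \<in> proper_subspaces scale"
  shows "0 < dim W" and "dim W < dim UNIV"
proof -
  have W: "subspace W" "W \<noteq> {0}" "W \<noteq> UNIV"
    using assms by (auto simp: proper_subspaces_def)
  then show "0 < dim W"
    using subspace_0[of W] by (auto simp del: neq0_conv simp: neq0_conv[symmetric])
  show "dim W < dim UNIV"
    using W dim_psubset[of W UNIV] by (metis psubsetI span_UNIV span_eq_iff subset_UNIV)
qed

text \<open>The dimension starts at \<open>1\<close> or more, grows at each step of the chain and stays below that
  of the whole space. For \<open>m = 0\<close> the conclusion is the assumption \<open>pos\<close>.\<close>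

lemma proper_subspace_chain_length:
  assumes proper: "\<And>i. i < m \<Longrightarrow> D i \<in> proper_subspaces scale"
    and strict: "\<And>i. Suc i < m \<Longrightarrow> D i \<subset> D (Suc i)"
    and pos: "0 < dim UNIV"
  shows "m < dim UNIV"
proof -
  have *: "Suc i \<le> dim (D i)" if "i < m" for i
    using that
  proof (induction i)
    case 0
    then show ?case
      using dim_proper_subspace(1)[OF proper[of 0]] by simp
  next
    case (Suc i)
    have "span (D i) = D i" "span (D (Suc i)) = D (Suc i)"
      using Suc.prems proper by (auto simp: proper_subspaces_def)
    then have "dim (D i) < dim (D (Suc i))"
      using strict[OF Suc.prems] by (intro dim_psubset) (simp only:)
    then show ?case
      using Suc by simp
  qed
  show ?thesis
  proof (cases m)
    case 0
    then show ?thesis using pos by simp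
  next
    case (Suc k)
    then show ?thesis
      using *[of k] dim_proper_subspace(2)[OF proper[of k]] by simp
  qed
qed

text \<open>The spans of the non-empty proper initial segments of an enumerated basis form a chain of
  the maximal length.\<close>

lemma proper_subspace_chain_exists:
  obtains C where "\<And>i. i < dim UNIV - 1 \<Longrightarrow> C i \<in> proper_subspaces scale"
    and "\<And>i. Suc i < dim UNIV - 1 \<Longrightarrow> C i \<subset> C (Suc i)"
proof -
  obtain bs where bs: "set bs = Basis" "distinct bs"
    using finite_distinct_list[OF finite_Basis] by blast
  have len: "length bs = dim UNIV"
    using bs distinct_card by fastforce
  define C where "C i = span (set (take (Suc i) bs))" for i
  have dimC: "dim (C i) = Suc i" if "i < dim UNIV" for i
  proof -
    have "independent (set (take (Suc i) bs))"
      using independent_mono[OF independent_Basis] bs(1) set_take_subset by metis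
    moreover have "card (set (take (Suc i) bs)) = Suc i"
      using that len bs(2) by (simp add: distinct_card)
    ultimately show ?thesis
      unfolding C_def by (simp add: dim_eq_card_independent)
  qed
  show ?thesis
  proof
    fix i assume i: "i < dim UNIV - 1"
    then have "dim (C i) \<noteq> dim {0}" "dim (C i) \<noteq> dim UNIV"
      using dimC[of i] by auto
    moreover have "subspace (C i)"
      by (simp add: C_def)
    ultimately show "C i \<in> proper_subspaces scale"
      unfolding proper_subspaces_def by fastforce
  next
    fix i assume "Suc i < dim UNIV - 1"
    then have "dim (C i) \<noteq> dim (C (Suc i))"
      using dimC[of i] dimC[of "Suc i"] by simp
    moreover have "C i \<subseteq> C (Suc i)"
      unfolding C_def by (intro span_mono set_take_subset_set_take) simp
    ultimately show "C i \<subset> C (Suc i)"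
      by auto
  qed
qed

end

text \<open>A chain of maximal length in the first space is carried by the order isomorphism to a chain
  of the same length in the second.\<close>

lemma dim_le_if_graph_iso:
  assumes "finite_dimensional_vector_space s1 B1" and "finite_dimensional_vector_space s2 B2"
    and pos: "0 < vector_space.dim s2 UNIV"
    and iso: "graph_iso (subspace_sum_graph s1) (subspace_sum_graph s2)"
  shows "vector_space.dim s1 UNIV \<le> vector_space.dim s2 UNIV"
proof -
  interpret v1: finite_dimensional_vector_space s1 B1 by fact
  interpret v2: finite_dimensional_vector_space s2 B2 by fact
  obtain \<phi> where bij: "bij_betw \<phi> (proper_subspaces s1) (proper_subspaces s2)"
    and le: "\<And>X Y. \<lbrakk>X \<in> proper_subspaces s1; Y \<in> proper_subspaces s1\<rbrakk>
      \<Longrightarrow> \<phi> X \<subseteq> \<phi> Y \<longleftrightarrow> X \<subseteq> Y"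
    using graph_iso_imp_order_iso[OF v1.vector_space_axioms v2.vector_space_axioms iso] by blast
  obtain C where C: "\<And>i. i < v1.dim UNIV - 1 \<Longrightarrow> C i \<in> proper_subspaces s1"
    and strict: "\<And>i. Suc i < v1.dim UNIV - 1 \<Longrightarrow> C i \<subset> C (Suc i)"
    using v1.proper_subspace_chain_exists by blast
  have "v1.dim UNIV - 1 < v2.dim UNIV"
  proof (rule v2.proper_subspace_chain_length[where D = "\<lambda>i. \<phi> (C i)"])
    show "\<phi> (C i) \<in> proper_subspaces s2" if "i < v1.dim UNIV - 1" for i
      using C[OF that] bij by (rule bij_betw_apply[rotated])
    show "\<phi> (C i) \<subset> \<phi> (C (Suc i))" if "Suc i < v1.dim UNIV - 1" for i
    proof -
      have "C i \<in> proper_subspaces s1" "C (Suc i) \<in> proper_subspaces s1"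
        using that by (auto intro: C)
      with strict[OF that] show ?thesis
        by (simp add: less_le_not_le le)
    qed
    show "0 < v2.dim UNIV" by (rule pos)
  qed
  then show ?thesis by linarith
qed

section \<open>Isomorphism of spaces and of graphs\<close>

lemma vector_space_iso_if_dim_eq:
  assumes "finite_dimensional_vector_space s1 B1" and "finite_dimensional_vector_space s2 B2"
    and "vector_space.dim s1 UNIV = vector_space.dim s2 UNIV"
  shows "vector_space_iso s1 s2"
proof -
  interpret finite_dimensional_vector_space_pair s1 B1 s2 B2
    using assms(1,2) by (simp add: finite_dimensional_vector_space_pair_def)
  show ?thesis
    using subspace_isomorphism[OF vs1.subspace_UNIV vs2.subspace_UNIV assms(3)]
    by (auto simp: vector_space_iso_def bij_def)
qed

theorem corollary5p2:
  fixes s1 :: "'a::field \<Rightarrow> 'v::ab_group_add \<Rightarrow> 'v"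
    and s2 :: "'a \<Rightarrow> 'w::ab_group_add \<Rightarrow> 'w"
  assumes "\<exists>B1. finite_dimensional_vector_space s1 B1"
    and "\<exists>B2. finite_dimensional_vector_space s2 B2"
    and "vector_space.dim s1 UNIV > 1"
    and "vector_space.dim s2 UNIV > 1"
  shows "vector_space_iso s1 s2 \<longleftrightarrow>
    graph_iso (subspace_sum_graph s1) (subspace_sum_graph s2)"
proof
  assume "vector_space_iso s1 s2"
  then show "graph_iso (subspace_sum_graph s1) (subspace_sum_graph s2)"
    by (rule graph_iso_if_vector_space_iso)
next
  assume iso: "graph_iso (subspace_sum_graph s1) (subspace_sum_graph s2)"
  obtain B1 B2 where fd: "finite_dimensional_vector_space s1 B1" "finite_dimensional_vector_space s2 B2"
    using assms(1,2) by blast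
  have "vector_space.dim s1 UNIV = vector_space.dim s2 UNIV"
    using dim_le_if_graph_iso[OF fd _ iso] dim_le_if_graph_iso[OF fd(2,1) _ graph_iso_sym[OF iso]]
      assms(3,4) by simp
  then show "vector_space_iso s1 s2"
    by (rule vector_space_iso_if_dim_eq[OF fd])
qed

end
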